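(* Let $\{z^k\}_{k\ge 0}\subset\mathbb{R}^n$ be a sequence generated by the ALM algorithm (described in the context) applied to the SOCMPCC, with associated penalty parameters $\{\rho^k\}$ and safeguarded multipliers $\{(\bar\lambda^k,\bar\mu^k,\bar\eta^k,\bar\Lambda^k,\bar\Gamma^k)\}$. Suppose that $z^*$ is a limit point of $\{z^k\}$ (i.e. the limit of some subsequence). If the penalty parameter sequence $\{\rho^k\}$ is bounded, or there exists a constant $\Upsilon>0$ such that $$L_{\rho^k}(z^k,\bar\lambda^k,\bar\mu^k,\bar\eta^k,\bar\Lambda^k,\bar\Gamma^k)\le\Upsilon\quad\text{for all }k,$$ then $z^*$ is feasible for the SOCMPCC.
   Context: **Problem.** Let $f:\mathbb{R}^n\to\mathbb{R}$, $g:\mathbb{R}^n\to\mathbb{R}^p$, $h:\mathbb{R}^n\to\mathbb{R}^q$, $G,H:\mathbb{R}^n\to\mathbb{R}^m$ be continuously differentiable. Let $m=\sum_{i=1}^J m_i$ and $\mathcal{K}=\mathcal{K}_1\times\cdots\times\mathcal{K}_J$, where $\mathcal{K}_i=\{(x_1,\bar x)\in\mathbb{R}\times\mathbb{R}^{m_i-1} : x_1\ge\|\bar x\|\}$ is the $m_i$-dimensional second-order cone ($\|\cdot\|$ Euclidean norm). The SOCMPCC is: minimize $f(z)$ subject to $g(z)\le 0$, $h(z)=0$, $G(z)\in\mathcal{K}$, $H(z)\in\mathcal{K}$, $G(z)^TH(z)=0$. A point is feasible if it satisfies all these constraints. **Notation.** $\mathcal{K}^\circ=\{w:\langle w,x\rangle\le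 0\ \forall x\in\mathcal{K}\}=-\mathcal{K}$ is the polar cone; $\Pi_C$ is the Euclidean projection onto a closed convex set $C$; $a_+=\max\{a,0\}$, and $\max$, $\min$ of vectors are componentwise. **Augmented Lagrangian.** For $\rho>0$, $$\begin{aligned}L_\rho(z,\lambda,\mu,\eta,\Lambda,\Gamma)=\ &f(z)+\tfrac{\rho}{2}\|(g(z)+\tfrac{\lambda}{\rho})_+\|^2+\tfrac{\rho}{2}\|h(z)+\tfrac{\mu}{\rho}\|^2+\tfrac{\rho}{2}\big(\|\Pi_{\mathcal{K}^\circ}(G(z)+\tfrac{\Lambda}{\rho})\|^2-\|\tfrac{\Lambda}{\rho}\|^2\big)\\&+\tfrac{\rho}{2}\big(\|\Pi_{\mathcal{K}^\circ}(H(z)+\tfrac{\Gamma}{\rho})\|^2-\|\tfrac{\Gamma}{\rho}\|^2\big)+\tfrac{\rho}{2}\big((\langle G(z),H(z)\rangle+\tfrac{\eta}{\rho})_+\big)^2 .\end{aligned}$$ **ALM algorithm.** Data: a nonincreasing sequence $\epsilon_k>0$ with $\epsilon_k\to0$; a nonempty convex compact set $B\subseteq\mathcal{K}^\circ$; $\tau>1$, $\sigma\in(0,1)$, $\rho^0>0$, $\lambda_{\max}>0$, $\mu_{\min}<\mu_{\max}$, $\eta_{\min}<\eta_{\max}$; initial $\bar\lambda^0\in[0,\lambda_{\max}]^p$, $\bar\mu^0\in[\mu_{\min},\mu_{\max}]^q$, $\bar\eta^0\in[\eta_{\min},\eta_{\max}]$, $\bar\Lambda^0,\bar\Gamma^0\in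 B$. For $k=0,1,2,\dots$: Step 1. If $k>0$, let $(\bar\lambda^k,\bar\mu^k,\bar\eta^k)$ be the projection of $(\lambda^k,\mu^k,\eta^k)$ onto $[0,\lambda_{\max}]^p\times[\mu_{\min},\mu_{\max}]^q\times[\eta_{\min},\eta_{\max}]$. Compute $z^k$ with $\|\nabla_zL_{\rho^k}(z^k,\bar\lambda^k,\bar\mu^k,\bar\eta^k,\bar\Lambda^k,\bar\Gamma^k)\|\le\epsilon_k$. Step 2. Set $\lambda^{k+1}=(\bar\lambda^k+\rho^kg(z^k))_+$, $\mu^{k+1}=\bar\mu^k+\rho^kh(z^k)$, $\eta^{k+1}=(\bar\eta^k+\rho^k\langle G(z^k),H(z^k)\rangle)_+$, $\Lambda^k=\rho^k\Pi_{\mathcal{K}^\circ}(G(z^k)+\bar\Lambda^k/\rho^k)$, $\Gamma^k=\rho^k\Pi_{\mathcal{K}^\circ}(H(z^k)+\bar\Gamma^k/\rho^k)$, $\bar\Lambda^{k+1}=\Pi_B(\Lambda^k)$, $\bar\Gamma^{k+1}=\Pi_B(\Gamma^k)$, $\zeta_{k+1}=\min\{\lambda^{k+1},-g(z^k)\}$, $\delta_{k+1}=\min\{\eta^{k+1},-\langle G(z^k),H(z^k)\rangle\}$, $V^k=\bar\Lambda^k/\rho^k-\Pi_{\mathcal{K}^\circ}(G(z^k)+\bar\Lambda^k/\rho^k)$, $U^k=\bar\Gamma^k/\rho^k-\Pi_{\mathcal{K}^\circ}(H(z^k)+\bar\Gamma^k/\rho^k)$. Step 3. If $k=0$, or if both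 $\max\{\|\zeta_{k+1}\|_\infty,|\delta_{k+1}|,\|h(z^k)\|_\infty\}\le\sigma\max\{\|\zeta_k\|_\infty,|\delta_k|,\|h(z^{k-1})\|_\infty\}$ and [$\|V^k\|\le\sigma\|V^{k-1}\|$ and $\|U^k\|\le\sigma\|U^{k-1}\|$] hold, set $\rho^{k+1}=\rho^k$; otherwise set $\rho^{k+1}=\tau\rho^k$. A "sequence generated by the algorithm" is an infinite sequence $\{z^k\}$ obtained in this way. *)

theory Defs
  imports "HOL-Analysis.Analysis"
begin

definition continuously_differentiable ::
    "('a::real_normed_vector \<Rightarrow> 'b::real_normed_vector) \<Rightarrow> bool" where
  "continuously_differentiable F \<longleftrightarrow>
     (\<exists>F' :: 'a \<Rightarrow> 'a \<Rightarrow>\<^sub>L 'b.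
        (\<forall>x. (F has_derivative blinfun_apply (F' x)) (at x)) \<and> continuous_on UNIV F')"

text \<open>
  Block structure: the coordinates of the product space are indexed by \<open>'m\<close>, the factors by
  \<open>'j\<close>. The map \<open>block\<close> sends a coordinate to the factor it belongs to, and \<open>hd_of j\<close> is the
  distinguished first coordinate of factor \<open>j\<close>. Thus the number of factors is \<open>CARD('j)\<close>, and
  factor \<open>j\<close> has dimension \<open>card {l. block l = j} \<ge> 1\<close>. These dimensions add up to \<open>CARD('m)\<close>.
\<close>

definition block_structure :: "('m \<Rightarrow> 'j) \<Rightarrow> ('j \<Rightarrow> 'm) \<Rightarrow> bool" where
  "block_structure block hd_of \<longleftrightarrow> (\<forall>j. block (hd_of j) = j)"

definition soc_product ::
    "('m::finite \<Rightarrow> 'j::finite) \<Rightarrow> ('j \<Rightarrow> 'm) \<Rightarrow> (real ^ 'm) set" where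
  "soc_product block hd_of =
     {x. \<forall>j. x $ hd_of j \<ge> L2_set (\<lambda>l. x $ l) {l. block l = j \<and> l \<noteq> hd_of j}}"

definition polar_cone :: "'a::real_inner set \<Rightarrow> 'a set" where
  "polar_cone C = {w. \<forall>x\<in>C. inner w x \<le> 0}"

definition vec_pos :: "real ^ 'i \<Rightarrow> real ^ 'i" where
  "vec_pos x = (\<chi> i. max (x $ i) 0)"

definition vec_min :: "real ^ 'i \<Rightarrow> real ^ 'i \<Rightarrow> real ^ 'i" where
  "vec_min x y = (\<chi> i. min (x $ i) (y $ i))"

definition vec_box :: "real \<Rightarrow> real \<Rightarrow> (real ^ 'i) set" where
  "vec_box a b = {x. \<forall>i. a \<le> x $ i \<and> x $ i \<le> b}"

definition socmpcc_feasible ::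
    "('x \<Rightarrow> real ^ 'p) \<Rightarrow> ('x \<Rightarrow> real ^ 'q) \<Rightarrow> ('x \<Rightarrow> real ^ 'm) \<Rightarrow> ('x \<Rightarrow> real ^ 'm)
      \<Rightarrow> (real ^ 'm::finite) set \<Rightarrow> 'x \<Rightarrow> bool" where
  "socmpcc_feasible g h G H K z \<longleftrightarrow>
     (\<forall>i. g z $ i \<le> 0) \<and> h z = 0 \<and> G z \<in> K \<and> H z \<in> K \<and> inner (G z) (H z) = 0"

definition aug_lagrangian ::
    "('x \<Rightarrow> real) \<Rightarrow> ('x \<Rightarrow> real ^ 'p::finite) \<Rightarrow> ('x \<Rightarrow> real ^ 'q::finite)
      \<Rightarrow> ('x \<Rightarrow> real ^ 'm) \<Rightarrow> ('x \<Rightarrow> real ^ 'm) \<Rightarrow> (real ^ 'm::finite) set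
      \<Rightarrow> real \<Rightarrow> 'x \<Rightarrow> real ^ 'p \<Rightarrow> real ^ 'q \<Rightarrow> real \<Rightarrow> real ^ 'm \<Rightarrow> real ^ 'm \<Rightarrow> real" where
  "aug_lagrangian f g h G H K \<rho> z lam \<mu> \<eta> \<Lambda> \<Gamma> =
     f z
     + \<rho> / 2 * (norm (vec_pos (g z + lam /\<^sub>R \<rho>)))\<^sup>2
     + \<rho> / 2 * (norm (h z + \<mu> /\<^sub>R \<rho>))\<^sup>2
     + \<rho> / 2 * ((norm (closest_point (polar_cone K) (G z + \<Lambda> /\<^sub>R \<rho>)))\<^sup>2 - (norm (\<Lambda> /\<^sub>R \<rho>))\<^sup>2)
     + \<rho> / 2 * ((norm (closest_point (polar_cone K) (H z + \<Gamma> /\<^sub>R \<rho>)))\<^sup>2 - (norm (\<Gamma> /\<^sub>R \<rho>))\<^sup>2)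
     + \<rho> / 2 * (max (inner (G z) (H z) + \<eta> / \<rho>) 0)\<^sup>2"

end

theory Submission
  imports Defs
begin

text \<open>
  If the penalties stay bounded, they are eventually constant, so the tests of Step 3 hold from some
  point on and force the residuals to decay geometrically. The conic residual controls the distance
  to \<open>K\<close> because, by the projection onto the polar cone, \<open>G(z) + V\<close> lies in the bipolar of \<open>K\<close>, which
  is \<open>K\<close> itself. If the penalties are unbounded, dividing the bound on the augmented Lagrangian by \<open>\<rho>\<close>
  and passing to the limit makes every squared infeasibility term vanish at the limit point. Either
  way \<open>\<langle>G, H\<rangle> \<le> 0\<close> in the limit, and the reverse inequality is self-duality of the second-order cone.
\<close>

section \<open>Polar cones and the projection onto them\<close>

lemma zero_mem_polar_cone: "0 \<in> polar_cone C"
  by (simp add: polar_cone_def)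

lemma add_mem_polar_cone: "x \<in> polar_cone C \<Longrightarrow> y \<in> polar_cone C \<Longrightarrow> x + y \<in> polar_cone C"
  by (simp add: polar_cone_def inner_add_left add_nonpos_nonpos)

lemma convex_polar_cone: "convex (polar_cone C)"
  unfolding convex_def polar_cone_def
  by (auto simp: inner_add_left intro!: add_nonpos_nonpos mult_nonneg_nonpos)

lemma closed_polar_cone: "closed (polar_cone C)"
proof -
  have "polar_cone C = (\<Inter>x\<in>C. {w. inner w x \<le> 0})"
    by (auto simp: polar_cone_def)
  then show ?thesis
    by (auto intro!: closed_Collect_le continuous_intros)
qed

text \<open>One half of Moreau's decomposition. The polar cone is closed under addition, so the
  variational inequality of the projection \<open>?p\<close> may be tested at \<open>?p + x\<close>
  for any polar \<open>x\<close>; the difference to \<open>?p\<close> is then \<open>x\<close>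
  itself.\<close>

lemma diff_closest_point_polar_cone:
  fixes C :: "'a::euclidean_space set"
  shows "y - closest_point (polar_cone C) y \<in> polar_cone (polar_cone C)"
proof -
  let ?p = "closest_point (polar_cone C) y"
  have p: "?p \<in> polar_cone C"
    using closed_polar_cone zero_mem_polar_cone by (metis closest_point_in_set empty_iff)
  have "inner (y - ?p) x \<le> 0" if "x \<in> polar_cone C" for x
    using closest_point_dot[OF convex_polar_cone closed_polar_cone add_mem_polar_cone[OF that p], of y]
    by simp
  then show ?thesis
    by (simp add: polar_cone_def[of "polar_cone C"])
qed

section \<open>Products of second-order cones: self-duality, bipolar and closedness\<close>

lemma sum_block_split:
  fixes a :: "'m::finite \<Rightarrow> real" and block :: "'m \<Rightarrow> 'j::finite"
  assumes "block_structure block hd_of"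
  shows "sum a UNIV = (\<Sum>j\<in>UNIV. a (hd_of j) + sum a {l. block l = j \<and> l \<noteq> hd_of j})"
proof -
  have "sum a UNIV = (\<Sum>j\<in>UNIV. sum a {l \<in> UNIV. block l = j})"
    by (rule sum.group[symmetric]) auto
  also have "\<dots> = (\<Sum>j\<in>UNIV. a (hd_of j) + sum a {l. block l = j \<and> l \<noteq> hd_of j})"
  proof (rule sum.cong[OF refl])
    fix j
    \<comment> \<open>The head lies in its own fibre of \<open>block\<close>, so each fibre is the
      head together with a tail not containing it.\<close>
    have "{l \<in> UNIV. block l = j} = insert (hd_of j) {l. block l = j \<and> l \<noteq> hd_of j}"
      using assms by (auto simp: block_structure_def)
    then show "sum a {l \<in> UNIV. block l = j}
        = a (hd_of j) + sum a {l. block l = j \<and> l \<noteq> hd_of j}"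
      by simp
  qed
  finally show ?thesis .
qed

lemma abs_sum_mult_le_L2_set: "\<bar>\<Sum>i\<in>A. f i * g i\<bar> \<le> L2_set f A * L2_set g A"
  using L2_set_mult_ineq[where A = A and f = f and g = g]
    sum_abs[of "\<lambda>i. f i * g i" A] by (simp add: abs_mult)

text \<open>In each block, Cauchy-Schwarz bounds the tail part of the inner product by the product
  of the tail norms. This is at most the product of the heads, since each head dominates its tail
  norm and is therefore nonnegative.\<close>

lemma inner_soc_product_nonneg:
  assumes bs: "block_structure block hd_of"
    and x: "x \<in> soc_product block hd_of" and y: "y \<in> soc_product block hd_of"
  shows "0 \<le> inner x y"
proof -
  have "0 \<le> x $ hd_of j * y $ hd_of j + (\<Sum>l | block l = j \<and> l \<noteq> hd_of j. x $ l * y $ l)" for j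
  proof -
    let ?R = "{l. block l = j \<and> l \<noteq> hd_of j}"
    have xj: "L2_set (\<lambda>l. x $ l) ?R \<le> x $ hd_of j" and yj: "L2_set (\<lambda>l. y $ l) ?R \<le> y $ hd_of j"
      using x y by (auto simp: soc_product_def)
    have "L2_set (\<lambda>l. x $ l) ?R * L2_set (\<lambda>l. y $ l) ?R \<le> x $ hd_of j * y $ hd_of j"
      using xj yj order_trans[OF L2_set_nonneg xj] by (intro mult_mono) auto
    then show ?thesis
      using abs_sum_mult_le_L2_set[of "\<lambda>l. x $ l" "\<lambda>l. y $ l" ?R] by linarith
  qed
  then show ?thesis
    by (simp add: inner_vec_def sum_block_split[OF bs] sum_nonneg)
qed

text \<open>No separation theorem is used: for each block \<open>j\<close> an explicit polar vector
  \<open>u\<close> supported on that block pairs with \<open>w\<close> to the tail norm minus the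
  head, and this pairing must be nonpositive.\<close>

lemma bipolar_soc_product_subset:
  assumes bs: "block_structure block hd_of"
  shows "polar_cone (polar_cone (soc_product block hd_of)) \<subseteq> soc_product block hd_of"
proof
  fix w assume w: "w \<in> polar_cone (polar_cone (soc_product block hd_of))"
  have "L2_set (\<lambda>l. w $ l) {l. block l = j \<and> l \<noteq> hd_of j} \<le> w $ hd_of j" for j
  proof -
    define R where "R = {l. block l = j \<and> l \<noteq> hd_of j}"
    define N where "N = L2_set (\<lambda>l. w $ l) R"
    \<comment> \<open>Polar direction attaining Cauchy--Schwarz against the tail of \<open>w\<close>; a zero tail
      is covered too, since \<open>w $ l / 0 = 0\<close>.\<close>
    define u where "u = (\<chi> l. if l = hd_of j then -1 else if block l = j then w $ l / N else 0)"
    have hd: "block (hd_of i) = i" for i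
      using bs by (simp add: block_structure_def)
    \<comment> \<open>Since \<open>u\<close> vanishes outside block \<open>j\<close>, only that
      block survives in the sum over all blocks.\<close>
    have u_inner: "inner u y = - y $ hd_of j + (\<Sum>l\<in>R. w $ l * y $ l) / N" for y
    proof -
      have "inner u y = (\<Sum>i\<in>UNIV. if i = j then - y $ hd_of j + (\<Sum>l\<in>R. w $ l * y $ l) / N else 0)"
        unfolding inner_vec_def sum_block_split[OF bs]
      proof (rule sum.cong[OF refl])
        fix i
        show "inner (u $ hd_of i) (y $ hd_of i)
            + (\<Sum>l | block l = i \<and> l \<noteq> hd_of i. inner (u $ l) (y $ l))
          = (if i = j then - y $ hd_of j + (\<Sum>l\<in>R. w $ l * y $ l) / N else 0)"
        proof (cases "i = j")
          case True
          then have "(\<Sum>l | block l = i \<and> l \<noteq> hd_of i. inner (u $ l) (y $ l))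
              = (\<Sum>l\<in>R. w $ l * y $ l / N)"
            by (intro sum.cong) (auto simp: R_def u_def)
          then show ?thesis
            using True by (simp add: u_def sum_divide_distrib)
        next
          case False
          then have "hd_of i \<noteq> hd_of j"
            using hd by metis
          moreover have "(\<Sum>l | block l = i \<and> l \<noteq> hd_of i. inner (u $ l) (y $ l)) = 0"
            using False hd by (intro sum.neutral) (auto simp: u_def)
          ultimately show ?thesis
            using False hd by (simp add: u_def)
        qed
      qed
      then show ?thesis
        by simp
    qed
    have N0: "0 \<le> N"
      by (simp add: N_def)
    have "u \<in> polar_cone (soc_product block hd_of)"
      unfolding polar_cone_def
    proof (intro CollectI ballI)
      fix y assume "y \<in> soc_product block hd_of"
      then have y: "L2_set (\<lambda>l. y $ l) R \<le> y $ hd_of j"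
        by (auto simp: soc_product_def R_def)
      have "(\<Sum>l\<in>R. w $ l * y $ l) \<le> N * L2_set (\<lambda>l. y $ l) R"
        using abs_sum_mult_le_L2_set[of "\<lambda>l. w $ l" "\<lambda>l. y $ l" R] by (simp add: N_def)
      \<comment> \<open>For \<open>N = 0\<close> the quotient is 0 by convention and the right side
        is nonnegative; otherwise divide by \<open>N > 0\<close>.\<close>
      then have "(\<Sum>l\<in>R. w $ l * y $ l) / N \<le> L2_set (\<lambda>l. y $ l) R"
        using N0 by (cases "N = 0") (auto simp: divide_le_eq mult.commute)
      then show "inner u y \<le> 0"
        using y by (simp add: u_inner)
    qed
    then have "inner w u \<le> 0"
      using w by (simp add: polar_cone_def[of "polar_cone (soc_product block hd_of)"])
    \<comment> \<open>At \<open>y = w\<close> the pairing formula becomes the negated head plus the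
      square of \<open>N\<close> divided by \<open>N\<close>, that is \<open>N\<close> minus the
      head, also when \<open>N = 0\<close>.\<close>
    moreover have "(\<Sum>l\<in>R. w $ l * w $ l) = N\<^sup>2"
      by (simp add: N_def L2_set_def sum_nonneg power2_eq_square)
    ultimately show ?thesis
      using u_inner[of w] by (simp add: inner_commute power2_eq_square N_def R_def)
  qed
  then show "w \<in> soc_product block hd_of"
    by (simp add: soc_product_def)
qed

text \<open>A set always lies in its bipolar, so the cone equals its bipolar, and every polar is
  closed.\<close>

lemma closed_soc_product:
  assumes "block_structure block hd_of"
  shows "closed (soc_product block hd_of)"
proof -
  have "soc_product block hd_of \<subseteq> polar_cone (polar_cone (soc_product block hd_of))"
    by (auto simp: polar_cone_def inner_commute)
  then have "soc_product block hd_of = polar_cone (polar_cone (soc_product block hd_of))"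
    using bipolar_soc_product_subset[OF assms] by blast
  then show ?thesis
    by (metis closed_polar_cone)
qed

section \<open>Multiplier boxes and continuity\<close>

lemma closed_vec_box: "closed (vec_box a b :: (real ^ 'i::finite) set)"
proof -
  have "vec_box a b = (\<Inter>i. {x :: real ^ 'i. a \<le> x $ i} \<inter> {x. x $ i \<le> b})"
    by (auto simp: vec_box_def)
  then show ?thesis
    by (auto intro!: closed_Collect_le closed_Int closed_INT continuous_intros)
qed

lemma bounded_vec_box: "bounded (vec_box a b :: (real ^ 'i::finite) set)"
proof (rule bounded_subset[OF bounded_cbox])
  show "(vec_box a b :: (real ^ 'i) set) \<subseteq> cbox (\<chi> i. a) (\<chi> i. b)"
    by (auto simp: vec_box_def mem_box_cart)
qed

lemma tendsto_vec_pos: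
  fixes x :: "'a \<Rightarrow> real ^ 'i::finite"
  assumes "(x \<longlongrightarrow> l) F"
  shows "((\<lambda>k. vec_pos (x k)) \<longlongrightarrow> vec_pos l) F"
  unfolding vec_pos_def by (intro tendsto_intros assms)

lemma continuously_differentiable_tendsto:
  assumes "continuously_differentiable F" "(x \<longlongrightarrow> a) net"
  shows "((\<lambda>k. F (x k)) \<longlongrightarrow> F a) net"
proof -
  have "isCont F a"
    using assms(1) has_derivative_continuous unfolding continuously_differentiable_def by blast
  then show ?thesis
    using assms(2) by (rule isCont_tendsto_compose)
qed

section \<open>Geometric decay of residuals and stabilization of the penalties\<close>

lemma tendsto_zero_of_contraction:
  fixes a :: "nat \<Rightarrow> real"
  assumes nonneg: "\<And>k. 0 \<le> a k" and s: "0 < s" "s < 1"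
    and step: "\<And>k. N \<le> k \<Longrightarrow> a (Suc k) \<le> s * a k"
  shows "a \<longlonglongrightarrow> 0"
proof -
  \<comment> \<open>The contraction is only available from \<open>N\<close> on, so the geometric
    bound starts there and the shift is removed at the end.\<close>
  have bound: "a (n + N) \<le> s ^ n * a N" for n
  proof (induction n)
    case (Suc n)
    have "a (Suc n + N) \<le> s * a (n + N)"
      using step[of "n + N"] by simp
    also have "\<dots> \<le> s * (s ^ n * a N)"
      using Suc s by (intro mult_left_mono) auto
    finally show ?case
      by simp
  qed simp
  have "(\<lambda>n. s ^ n * a N) \<longlonglongrightarrow> 0"
    using s by (intro tendsto_mult_left_zero LIMSEQ_power_zero) auto
  then have "(\<lambda>n. a (n + N)) \<longlonglongrightarrow> 0"
    by (rule Lim_null_comparison[rotated]) (simp add: nonneg bound)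
  then show ?thesis
    by (rule LIMSEQ_offset)
qed

text \<open>A bounded monotone sequence converges, so its increments tend to 0. A multiplication by
  \<open>\<tau>\<close> at index \<open>k\<close> has increment
  \<open>(\<tau> - 1) * \<rho> k\<close>, which by monotonicity is at least the fixed positive
  number \<open>(\<tau> - 1) * \<rho> 0\<close>.\<close>

lemma geometric_steps_eventually_constant:
  fixes \<rho> :: "nat \<Rightarrow> real"
  assumes "1 < \<tau>" "0 < \<rho> 0" "incseq \<rho>" "bounded (range \<rho>)"
  shows "\<exists>N. \<forall>k\<ge>N. \<rho> (Suc k) \<noteq> \<tau> * \<rho> k"
proof -
  obtain L where L: "\<rho> \<longlonglongrightarrow> L"
    using assms(3,4) by (metis Bseq_eq_bounded Bseq_monoseq_convergent convergentD incseq_imp_monoseq)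
  have "(\<lambda>k. \<rho> (Suc k) - \<rho> k) \<longlonglongrightarrow> 0"
    using tendsto_diff[OF LIMSEQ_Suc[OF L] L] by simp
  moreover have "0 < (\<tau> - 1) * \<rho> 0"
    using assms by simp
  ultimately have "eventually (\<lambda>k. \<rho> (Suc k) - \<rho> k < (\<tau> - 1) * \<rho> 0) sequentially"
    by (rule order_tendstoD)
  moreover have "\<rho> (Suc k) \<noteq> \<tau> * \<rho> k" if "\<rho> (Suc k) - \<rho> k < (\<tau> - 1) * \<rho> 0" for k
  proof -
    have "(\<tau> - 1) * \<rho> 0 \<le> (\<tau> - 1) * \<rho> k"
      using assms by (intro mult_left_mono) (auto simp: incseq_def)
    also have "\<dots> = \<tau> * \<rho> k - \<rho> k"
      by (simp add: left_diff_distrib)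
    finally show ?thesis
      using that by linarith
  qed
  ultimately have "eventually (\<lambda>k. \<rho> (Suc k) \<noteq> \<tau> * \<rho> k) sequentially"
    by (rule eventually_mono)
  then show ?thesis
    by (simp add: eventually_sequentially)
qed

section \<open>Cone membership from projections, and vanishing scaled multipliers\<close>

lemma tendsto_closest_point_residual_mem:
  fixes x v :: "nat \<Rightarrow> 'a::euclidean_space"
  assumes "x \<longlonglongrightarrow> a" "closed C" "polar_cone (polar_cone C) \<subseteq> C"
    and v: "(\<lambda>k. s k - closest_point (polar_cone C) (x k + s k)) \<longlonglongrightarrow> 0"
  shows "a \<in> C"
proof (rule closed_sequentially[OF assms(2)])
  show "(\<lambda>k. x k + (s k - closest_point (polar_cone C) (x k + s k))) \<longlonglongrightarrow> a"
    using tendsto_add[OF assms(1) v] by simp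
  \<comment> \<open>Regrouped, this point is \<open>x k + s k\<close> minus its own projection onto
    the polar cone, hence an element of the bipolar.\<close>
  show "x k + (s k - closest_point (polar_cone C) (x k + s k)) \<in> C" for k
    using diff_closest_point_polar_cone[of "x k + s k" C] assms(3)
    by (auto simp: add_diff_eq)
qed

text \<open>With zero projection, \<open>y\<close> coincides with its Moreau remainder, which lies
  in the bipolar.\<close>

lemma closest_point_polar_cone_eq_0_imp_mem:
  fixes C :: "'a::euclidean_space set"
  assumes "closest_point (polar_cone C) y = 0" "polar_cone (polar_cone C) \<subseteq> C"
  shows "y \<in> C"
  using diff_closest_point_polar_cone[of y C] assms by auto

lemma tendsto_closest_point_polar_cone:
  fixes x :: "'b \<Rightarrow> 'a::euclidean_space"
  assumes "(x \<longlongrightarrow> a) F"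
  shows "((\<lambda>k. closest_point (polar_cone C) (x k)) \<longlongrightarrow> closest_point (polar_cone C) a) F"
proof -
  have "isCont (closest_point (polar_cone C)) a"
    using zero_mem_polar_cone[of C]
    by (intro continuous_at_closest_point convex_polar_cone closed_polar_cone) auto
  then show ?thesis
    using assms by (rule isCont_tendsto_compose)
qed

text \<open>Serves to remove the safeguarded multipliers from the limit when the penalties
  diverge.\<close>

lemma bounded_scaleR_inverse_tendsto_0:
  fixes x :: "nat \<Rightarrow> 'a::real_normed_vector"
  assumes "bounded S" "\<And>k. x k \<in> S" "filterlim \<rho> at_top sequentially"
  shows "(\<lambda>k. x k /\<^sub>R \<rho> k) \<longlonglongrightarrow> 0"
proof -
  obtain M where M: "\<And>k. norm (x k) \<le> M"
    using assms(1,2) by (metis bounded_iff)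
  show ?thesis
  proof (rule Lim_null_comparison)
    show "eventually (\<lambda>k. norm (x k /\<^sub>R \<rho> k) \<le> M * inverse \<bar>\<rho> k\<bar>) sequentially"
      by (intro always_eventually allI)
        (auto simp: mult.commute[of _ "inverse _"] intro!: mult_left_mono M)
    have "(\<lambda>k. inverse (\<rho> k)) \<longlonglongrightarrow> 0"
      using assms(3) by (rule tendsto_inverse_0_at_top)
    then have "(\<lambda>k. M * \<bar>inverse (\<rho> k)\<bar>) \<longlonglongrightarrow> 0"
      by (intro tendsto_mult_right_zero tendsto_rabs_zero)
    then show "(\<lambda>k. M * inverse \<bar>\<rho> k\<bar>) \<longlonglongrightarrow> 0"
      by simp
  qed
qed


section \<open>Feasibility of limit points of the augmented Lagrangian method\<close>

theorem theorem3p1: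
  fixes f :: "real ^ 'n \<Rightarrow> real"
    and g :: "real ^ 'n \<Rightarrow> real ^ 'p"
    and h :: "real ^ 'n \<Rightarrow> real ^ 'q"
    and G H :: "real ^ 'n \<Rightarrow> real ^ 'm"
    and block :: "'m \<Rightarrow> 'j::finite" and hd_of :: "'j \<Rightarrow> 'm"
    and K B :: "(real ^ 'm) set"
    and \<epsilon> \<rho> :: "nat \<Rightarrow> real"
    and \<tau> \<sigma> lam_max \<mu>_min \<mu>_max \<eta>_min \<eta>_max :: real
    and z :: "nat \<Rightarrow> real ^ 'n"
    and lam lam_bar \<zeta> :: "nat \<Rightarrow> real ^ 'p"
    and \<mu> \<mu>_bar :: "nat \<Rightarrow> real ^ 'q"
    and \<eta> \<eta>_bar \<delta> :: "nat \<Rightarrow> real"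
    and \<Lambda> \<Lambda>_bar \<Gamma> \<Gamma>_bar U V :: "nat \<Rightarrow> real ^ 'm"
    and z_star :: "real ^ 'n"
  assumes problem:
      "continuously_differentiable f" "continuously_differentiable g"
      "continuously_differentiable h" "continuously_differentiable G"
      "continuously_differentiable H"
      "block_structure block hd_of" "K = soc_product block hd_of"
    and data:
      "\<And>k. \<epsilon> k > 0" "decseq \<epsilon>" "\<epsilon> \<longlonglongrightarrow> 0"
      "B \<noteq> {}" "convex B" "compact B" "B \<subseteq> polar_cone K"
      "\<tau> > 1" "0 < \<sigma>" "\<sigma> < 1" "\<rho> 0 > 0"
      "lam_max > 0" "\<mu>_min < \<mu>_max" "\<eta>_min < \<eta>_max"
    and initial:
      "lam_bar 0 \<in> vec_box 0 lam_max" "\<mu>_bar 0 \<in> vec_box \<mu>_min \<mu>_max"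
      "\<eta>_bar 0 \<in> {\<eta>_min..\<eta>_max}" "\<Lambda>_bar 0 \<in> B" "\<Gamma>_bar 0 \<in> B"
    and step1_safeguard:
      "\<And>k. k > 0 \<Longrightarrow>
         (lam_bar k, \<mu>_bar k, \<eta>_bar k) =
           closest_point (vec_box 0 lam_max \<times> vec_box \<mu>_min \<mu>_max \<times> {\<eta>_min..\<eta>_max})
             (lam k, \<mu> k, \<eta> k)"
    and step1_iterate:
      "\<And>k. \<exists>D. (GDERIV (\<lambda>x. aug_lagrangian f g h G H K (\<rho> k) x
                          (lam_bar k) (\<mu>_bar k) (\<eta>_bar k) (\<Lambda>_bar k) (\<Gamma>_bar k)) (z k) :> D)
                \<and> norm D \<le> \<epsilon> k"
    and step2:
      "\<And>k. lam (Suc k) = vec_pos (lam_bar k + \<rho> k *\<^sub>R g (z k))"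
      "\<And>k. \<mu> (Suc k) = \<mu>_bar k + \<rho> k *\<^sub>R h (z k)"
      "\<And>k. \<eta> (Suc k) = max (\<eta>_bar k + \<rho> k * inner (G (z k)) (H (z k))) 0"
      "\<And>k. \<Lambda> k = \<rho> k *\<^sub>R closest_point (polar_cone K) (G (z k) + \<Lambda>_bar k /\<^sub>R \<rho> k)"
      "\<And>k. \<Gamma> k = \<rho> k *\<^sub>R closest_point (polar_cone K) (H (z k) + \<Gamma>_bar k /\<^sub>R \<rho> k)"
      "\<And>k. \<Lambda>_bar (Suc k) = closest_point B (\<Lambda> k)"
      "\<And>k. \<Gamma>_bar (Suc k) = closest_point B (\<Gamma> k)"
      "\<And>k. \<zeta> (Suc k) = vec_min (lam (Suc k)) (- g (z k))"
      "\<And>k. \<delta> (Suc k) = min (\<eta> (Suc k)) (- inner (G (z k)) (H (z k)))"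
      "\<And>k. V k = \<Lambda>_bar k /\<^sub>R \<rho> k
                 - closest_point (polar_cone K) (G (z k) + \<Lambda>_bar k /\<^sub>R \<rho> k)"
      "\<And>k. U k = \<Gamma>_bar k /\<^sub>R \<rho> k
                 - closest_point (polar_cone K) (H (z k) + \<Gamma>_bar k /\<^sub>R \<rho> k)"
    and step3:
      "\<And>k. \<rho> (Suc k) =
         (if k = 0 \<or>
             (Max {infnorm (\<zeta> (Suc k)), \<bar>\<delta> (Suc k)\<bar>, infnorm (h (z k))}
                \<le> \<sigma> * Max {infnorm (\<zeta> k), \<bar>\<delta> k\<bar>, infnorm (h (z (k - 1)))}
              \<and> norm (V k) \<le> \<sigma> * norm (V (k - 1))
              \<and> norm (U k) \<le> \<sigma> * norm (U (k - 1)))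
          then \<rho> k else \<tau> * \<rho> k)"
    and limit_point: "\<exists>r. strict_mono r \<and> (z \<circ> r) \<longlonglongrightarrow> z_star"
    and alternative:
      "bounded (range \<rho>) \<or>
       (\<exists>\<Upsilon>>0. \<forall>k. aug_lagrangian f g h G H K (\<rho> k) (z k)
                      (lam_bar k) (\<mu>_bar k) (\<eta>_bar k) (\<Lambda>_bar k) (\<Gamma>_bar k) \<le> \<Upsilon>)"
  shows "socmpcc_feasible g h G H K z_star"
proof -
  obtain r where r: "strict_mono r" and zr: "(z \<circ> r) \<longlonglongrightarrow> z_star"
    using limit_point by blast
  have z: "(\<lambda>k. z (r k)) \<longlonglongrightarrow> z_star"
    using zr by (simp add: comp_def)
  note lims = problem(1-5)[THEN continuously_differentiable_tendsto, OF z]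
  have Kclosed: "closed K" and bipolar: "polar_cone (polar_cone K) \<subseteq> K"
    using closed_soc_product[OF problem(6)] bipolar_soc_product_subset[OF problem(6)]
    unfolding problem(7) by blast+
  have \<rho>_pos: "0 < \<rho> k" for k
    by (induction k) (use data in \<open>auto simp: step3\<close>)
  have \<rho>_step: "\<rho> k \<le> \<rho> (Suc k)" for k
    using \<rho>_pos[of k] data(8) by (auto simp: step3)
  then have \<rho>_mono: "incseq \<rho>"
    by (rule incseq_SucI)
  \<comment> \<open>Complementarity is first obtained as an inequality: both \<open>\<delta>\<close>
    and the squared positive part in the Lagrangian control the inner product only from
    above.\<close>
  have "(\<forall>i. g z_star $ i \<le> 0) \<and> h z_star = 0 \<and> G z_star \<in> K \<and> H z_star \<in> K
      \<and> inner (G z_star) (H z_star) \<le> 0"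
  proof (cases "bounded (range \<rho>)")

    \<comment> \<open>Bounded penalties: decay of the residuals\<close>
    case True
    obtain N where N: "\<And>k. N \<le> k \<Longrightarrow> \<rho> (Suc k) \<noteq> \<tau> * \<rho> k"
      using geometric_steps_eventually_constant[OF data(8) data(11) \<rho>_mono True] by blast
    \<comment> \<open>Iteration \<open>k\<close> produces \<open>\<zeta>\<close> and
      \<open>\<delta>\<close> with index \<open>k + 1\<close> but uses \<open>h\<close> at
      \<open>z k\<close>. With this indexing, Step 3 at iteration \<open>k + 1\<close> compares
      \<open>e (Suc k)\<close> with \<open>e k\<close>.\<close>
    define e where "e k = Max {infnorm (\<zeta> (Suc k)), \<bar>\<delta> (Suc k)\<bar>, infnorm (h (z k))}" for k
    \<comment> \<open>At index \<open>Suc k\<close> the exemption for the first iteration does not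
      apply, and the penalty is not multiplied by \<open>\<tau>\<close>, so the test itself must
      have succeeded.\<close>
    have test: "e (Suc k) \<le> \<sigma> * e k \<and> norm (V (Suc k)) \<le> \<sigma> * norm (V k)
        \<and> norm (U (Suc k)) \<le> \<sigma> * norm (U k)" if "N \<le> k" for k
      using N[of "Suc k"] that step3[of "Suc k"] unfolding e_def
      by (auto split: if_splits)
    have e_ge: "infnorm (\<zeta> (Suc k)) \<le> e k" "\<bar>\<delta> (Suc k)\<bar> \<le> e k" "infnorm (h (z k)) \<le> e k" for k
      unfolding e_def by (auto intro!: Max_ge)
    have e_nonneg: "0 \<le> e k" for k
      using e_ge(2)[of k] by linarith
    have "e \<longlonglongrightarrow> 0"
      using test by (intro tendsto_zero_of_contraction[OF e_nonneg data(9,10)]) auto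
    \<comment> \<open>The tests link consecutive iterations, so decay is proved along the full
      sequence; only then is it restricted to the subsequence on which \<open>z\<close>
      converges.\<close>
    then have e_lim: "(\<lambda>k. e (r k)) \<longlonglongrightarrow> 0"
      using LIMSEQ_subseq_LIMSEQ[OF _ r, of e 0] by (simp add: comp_def)
    have "(\<lambda>k. norm (V k)) \<longlonglongrightarrow> 0" "(\<lambda>k. norm (U k)) \<longlonglongrightarrow> 0"
      using test by (intro tendsto_zero_of_contraction[OF _ data(9,10)]; auto)+
    then have V_lim: "(\<lambda>k. V (r k)) \<longlonglongrightarrow> 0" and U_lim: "(\<lambda>k. U (r k)) \<longlonglongrightarrow> 0"
      using LIMSEQ_subseq_LIMSEQ[OF _ r, of V 0] LIMSEQ_subseq_LIMSEQ[OF _ r, of U 0]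
      by (auto simp: comp_def tendsto_norm_zero_iff)
    have "g z_star $ i \<le> 0" for i
    proof (rule LIMSEQ_le[OF tendsto_vec_nth[OF lims(2)] e_lim])
      have "g (z k) $ i \<le> e k" for k
      proof -
        \<comment> \<open>The minimum is at most its second argument, so \<open>g\<close> is bounded
          by the negative of \<open>\<zeta>\<close> and hence by its sup norm.\<close>
        have "\<zeta> (Suc k) $ i \<le> - g (z k) $ i"
          by (simp add: step2(8) vec_min_def)
        then show ?thesis
          using component_le_infnorm_cart[of "\<zeta> (Suc k)" i] e_ge(1)[of k] by linarith
      qed
      then show "\<exists>M. \<forall>n\<ge>M. g (z (r n)) $ i \<le> e (r n)"
        by blast
    qed
    moreover have "h z_star = 0"
    proof -
      have "infnorm (h z_star) \<le> 0"
        using LIMSEQ_le[OF tendsto_infnorm[OF lims(3)] e_lim] e_ge(3) by blast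
      then show ?thesis
        using infnorm_pos_le[of "h z_star"] by (simp add: infnorm_eq_0)
    qed
    \<comment> \<open>\<open>V\<close> and \<open>U\<close> are exactly the projection residuals
      whose shifts are the safeguarded multipliers divided by the penalty.\<close>
    moreover have "G z_star \<in> K" "H z_star \<in> K"
      using tendsto_closest_point_residual_mem[OF lims(4) Kclosed bipolar V_lim[unfolded step2(10)]]
        tendsto_closest_point_residual_mem[OF lims(5) Kclosed bipolar U_lim[unfolded step2(11)]]
      by auto
    moreover have "inner (G z_star) (H z_star) \<le> 0"
    proof (rule LIMSEQ_le[OF tendsto_inner[OF lims(4,5)] e_lim])
      have "inner (G (z k)) (H (z k)) \<le> e k" for k
        using step2(9)[of k] e_ge(2)[of k] by linarith
      then show "\<exists>M. \<forall>n\<ge>M. inner (G (z (r n))) (H (z (r n))) \<le> e (r n)"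
        by blast
    qed
    ultimately show ?thesis
      by blast
  next

    \<comment> \<open>Unbounded penalties: the rescaled Lagrangian bound\<close>
    case False
    then obtain \<Upsilon> where \<Upsilon>: "\<And>k. aug_lagrangian f g h G H K (\<rho> k) (z k)
        (lam_bar k) (\<mu>_bar k) (\<eta>_bar k) (\<Lambda>_bar k) (\<Gamma>_bar k) \<le> \<Upsilon>"
      using alternative by blast
    have "filterlim \<rho> at_top sequentially"
      unfolding filterlim_at_top
    proof
      fix C
      obtain N where "C < \<rho> N"
        using False \<rho>_pos unfolding bounded_iff by (force simp: not_le less_imp_le abs_of_pos)
      then have "\<forall>k\<ge>N. C \<le> \<rho> k"
        using \<rho>_mono by (meson incseqD less_imp_le order_trans)
      then show "eventually (\<lambda>k. C \<le> \<rho> k) sequentially"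
        by (auto simp: eventually_sequentially)
    qed
    then have \<rho>_lim: "filterlim (\<lambda>k. \<rho> (r k)) at_top sequentially"
      using filterlim_compose filterlim_subseq[OF r] by blast
    let ?box = "vec_box 0 lam_max \<times> vec_box \<mu>_min \<mu>_max \<times> {\<eta>_min..\<eta>_max} :: ((real^'p) \<times> (real^'q) \<times> real) set"
    have box_mem: "(lam_bar k, \<mu>_bar k, \<eta>_bar k) \<in> ?box" for k
    proof (cases "k = 0")
      case True
      then show ?thesis
        using initial by simp
    next
      case False
      have "closed ?box"
        by (intro closed_Times closed_vec_box closed_atLeastAtMost)
      moreover have "?box \<noteq> {}"
        using initial(1-3) by blast
      ultimately have "closest_point ?box (lam k, \<mu> k, \<eta> k) \<in> ?box"
        by (rule closest_point_in_set)
      then show ?thesis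
        using step1_safeguard[of k] False by simp
    qed
    \<comment> \<open>Safeguarding confines all multipliers to fixed bounded sets, however fast the
      unprojected ones grow, so their quotients by the diverging penalties vanish.\<close>
    have "\<Lambda>_bar k \<in> B" "\<Gamma>_bar k \<in> B" for k
      using initial step2(6,7) closest_point_in_set[OF compact_imp_closed[OF data(6)] data(4)]
      by (cases k; simp)+
    then have mult_lims:
      "(\<lambda>k. lam_bar (r k) /\<^sub>R \<rho> (r k)) \<longlonglongrightarrow> 0" "(\<lambda>k. \<mu>_bar (r k) /\<^sub>R \<rho> (r k)) \<longlonglongrightarrow> 0"
      "(\<lambda>k. \<eta>_bar (r k) /\<^sub>R \<rho> (r k)) \<longlonglongrightarrow> 0" "(\<lambda>k. \<Lambda>_bar (r k) /\<^sub>R \<rho> (r k)) \<longlonglongrightarrow> 0"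
      "(\<lambda>k. \<Gamma>_bar (r k) /\<^sub>R \<rho> (r k)) \<longlonglongrightarrow> 0"
      using box_mem
        bounded_scaleR_inverse_tendsto_0[OF bounded_vec_box[of 0 lam_max] _ \<rho>_lim, of "\<lambda>k. lam_bar (r k)"]
        bounded_scaleR_inverse_tendsto_0[OF bounded_vec_box[of \<mu>_min \<mu>_max] _ \<rho>_lim, of "\<lambda>k. \<mu>_bar (r k)"]
        bounded_scaleR_inverse_tendsto_0[OF bounded_closed_interval[of \<eta>_min \<eta>_max] _ \<rho>_lim, of "\<lambda>k. \<eta>_bar (r k)"]
        bounded_scaleR_inverse_tendsto_0[OF compact_imp_bounded[OF data(6)] _ \<rho>_lim]
      by auto
    have \<rho>_inv: "(\<lambda>k. inverse (\<rho> (r k))) \<longlonglongrightarrow> 0"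
      using \<rho>_lim by (rule tendsto_inverse_0_at_top)
    let ?P = "closest_point (polar_cone K)"
    \<comment> \<open>The augmented Lagrangian divided by \<open>\<rho> k\<close>: the objective
      gets a vanishing factor, while the infeasibility terms keep the fixed weight 1/2.\<close>
    define \<psi> where "\<psi> k = inverse (\<rho> k) * f (z k)
      + ((norm (vec_pos (g (z k) + lam_bar k /\<^sub>R \<rho> k)))\<^sup>2
       + (norm (h (z k) + \<mu>_bar k /\<^sub>R \<rho> k))\<^sup>2
       + ((norm (?P (G (z k) + \<Lambda>_bar k /\<^sub>R \<rho> k)))\<^sup>2 - (norm (\<Lambda>_bar k /\<^sub>R \<rho> k))\<^sup>2)
       + ((norm (?P (H (z k) + \<Gamma>_bar k /\<^sub>R \<rho> k)))\<^sup>2 - (norm (\<Gamma>_bar k /\<^sub>R \<rho> k))\<^sup>2)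
       + (max (inner (G (z k)) (H (z k)) + \<eta>_bar k /\<^sub>R \<rho> k) 0)\<^sup>2) / 2" for k
    have "aug_lagrangian f g h G H K (\<rho> k) (z k)
        (lam_bar k) (\<mu>_bar k) (\<eta>_bar k) (\<Lambda>_bar k) (\<Gamma>_bar k) = \<rho> k * \<psi> k" for k
    proof -
      \<comment> \<open>The five penalty terms are abstracted to real variables, so that clearing
        denominators does not open the norms, which themselves contain divisions by
        \<open>\<rho> k\<close>.\<close>
      have "\<rho> k * (inverse (\<rho> k) * f (z k) + (a + b + c + d + e) / 2)
        = f (z k) + \<rho> k / 2 * a + \<rho> k / 2 * b + \<rho> k / 2 * c + \<rho> k / 2 * d + \<rho> k / 2 * e"
        for a b c d e :: real
        using \<rho>_pos[of k] by (simp add: field_simps)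
      then show ?thesis
        unfolding aug_lagrangian_def \<psi>_def by (simp only: real_scaleR_def divide_inverse mult.commute)
    qed
    then have \<psi>_le: "\<psi> k \<le> \<Upsilon> * inverse (\<rho> k)" for k
      using \<Upsilon>[of k] \<rho>_pos[of k] by (simp add: field_simps)
    \<comment> \<open>The values of \<open>f\<close> converge along the subsequence, so their
      rescaled contribution is 0. The summands \<open>+ 0\<close> are the limits of the scaled
      multipliers, kept so that the limit has the shape the continuity rules produce.\<close>
    have "(\<lambda>k. \<psi> (r k)) \<longlonglongrightarrow> 0 * f z_star
      + ((norm (vec_pos (g z_star + 0)))\<^sup>2 + (norm (h z_star + 0))\<^sup>2
       + ((norm (?P (G z_star + 0)))\<^sup>2 - (norm (0 :: real ^ 'm))\<^sup>2)
       + ((norm (?P (H z_star + 0)))\<^sup>2 - (norm (0 :: real ^ 'm))\<^sup>2)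
       + (max (inner (G z_star) (H z_star) + 0) 0)\<^sup>2) / 2"
      unfolding \<psi>_def
      by (intro tendsto_intros tendsto_vec_pos tendsto_closest_point_polar_cone
          tendsto_max lims mult_lims \<rho>_inv) auto
    moreover have "(\<lambda>k. \<Upsilon> * inverse (\<rho> (r k))) \<longlonglongrightarrow> 0"
      using \<rho>_inv by (rule tendsto_mult_right_zero)
    \<comment> \<open>The limit of \<open>\<psi>\<close> is at most the limit of
      \<open>\<Upsilon> * inverse (\<rho> (r k))\<close>, which is 0; being half a sum of squares,
      it forces each square to vanish.\<close>
    ultimately have le0: "(norm (vec_pos (g z_star)))\<^sup>2 + (norm (h z_star))\<^sup>2
       + (norm (?P (G z_star)))\<^sup>2 + (norm (?P (H z_star)))\<^sup>2
       + (max (inner (G z_star) (H z_star)) 0)\<^sup>2 \<le> 0"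
      using LIMSEQ_le \<psi>_le by fastforce
    have zero: "a = 0 \<and> b = 0 \<and> c = 0 \<and> d = 0 \<and> e = 0"
      if "a\<^sup>2 + b\<^sup>2 + c\<^sup>2 + d\<^sup>2 + e\<^sup>2 \<le> 0" for a b c d e :: real
      using that zero_le_power2[of a] zero_le_power2[of b] zero_le_power2[of c]
        zero_le_power2[of d] zero_le_power2[of e]
      by (smt (verit) power2_eq_iff zero_eq_power2)
    have eqs: "vec_pos (g z_star) = 0" "h z_star = 0" "?P (G z_star) = 0" "?P (H z_star) = 0"
      "max (inner (G z_star) (H z_star)) 0 = 0"
      using zero[OF le0] by auto
    have "g z_star $ i \<le> 0" for i
      using eqs(1) by (metis max.cobounded1 vec_lambda_beta vec_pos_def zero_index)
    then show ?thesis
      using eqs(2,5) closest_point_polar_cone_eq_0_imp_mem[OF eqs(3) bipolar]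
        closest_point_polar_cone_eq_0_imp_mem[OF eqs(4) bipolar]
      by auto
  qed
  moreover from this have "0 \<le> inner (G z_star) (H z_star)"
    using inner_soc_product_nonneg problem(6,7) by blast
  ultimately show ?thesis
    by (simp add: socmpcc_feasible_def order_antisym)
qed

end
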